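(* For every $\varepsilon>0$, $$\lim_{t\to\infty}\mathbb P\Big(\big(2H^{-1}(1/2)-\varepsilon\big)t\ \le\ X(2,t,1)\ \le\ (0.4+\varepsilon)t\Big)=1,$$ where $2H^{-1}(1/2)=0.220\ldots$. That is, whp $X(2,t,1)\ge 2H^{-1}(1/2)t-o(t)$ and $X(2,t,1)\le 0.4t+o(t)$.
   Context: For positive integers $k,t,m$, a random necklace is an open necklace (a linear sequence) of $ktm$ beads, containing exactly $km$ beads of each of $t$ types, chosen uniformly at random among all such sequences. A set of cuts (positions between consecutive beads) is called fair if the resulting intervals can be split into $k$ collections each containing exactly $m$ beads of each type. $X(k,t,m)$ denotes the minimum number of cuts in a fair set of cuts. Here $k=2,m=1$: $2t$ beads, two of each type. $H(x)=-x\log_2 x-(1-x)\log_2(1-x)$ is the binary entropy function and $H^{-1}$ denotes its inverse taking values in $[0,1/2]$. *)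

theory Defs
  imports "HOL-Probability.Probability"
begin

text \<open>An open necklace is the list of the types of its beads; the \<open>t\<close> types are \<open>0, \<dots>, t - 1\<close>.\<close>

definition necklaces :: "nat \<Rightarrow> nat \<Rightarrow> nat \<Rightarrow> nat list set" where
  "necklaces k t m =
     {xs. length xs = k * t * m \<and> set xs \<subseteq> {..<t} \<and> (\<forall>i<t. count_list xs i = k * m)}"

definition random_necklace :: "nat \<Rightarrow> nat \<Rightarrow> nat \<Rightarrow> nat list pmf" where
  "random_necklace k t m = pmf_of_set (necklaces k t m)"

text \<open>
  The cut \<open>c\<close> separates the beads \<open>c - 1\<close> and \<open>c\<close> (beads are numbered from \<open>0\<close>), so the possible
  cuts of \<open>xs\<close> are \<open>1, \<dots>, length xs - 1\<close>. A set \<open>C\<close> of cuts yields \<open>card C + 1\<close> intervals,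
  numbered \<open>0, \<dots>, card C\<close> from left to right, and the number of the interval containing bead \<open>p\<close>
  is the number of cuts to the left of \<open>p\<close>.
\<close>

definition interval_of :: "nat set \<Rightarrow> nat \<Rightarrow> nat" where
  "interval_of C p = card {c \<in> C. c \<le> p}"

text \<open>The function \<open>f\<close> below maps each interval to the collection that receives it.\<close>

definition fair :: "nat \<Rightarrow> nat \<Rightarrow> nat \<Rightarrow> nat list \<Rightarrow> nat set \<Rightarrow> bool" where
  "fair k t m xs C \<longleftrightarrow>
     C \<subseteq> {1..<length xs} \<and>
     (\<exists>f :: nat \<Rightarrow> nat.
        (\<forall>j\<le>card C. f j < k) \<and>
        (\<forall>a<k. \<forall>i<t. card {p. p < length xs \<and> f (interval_of C p) = a \<and> xs ! p = i} = m))"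

definition min_cuts :: "nat \<Rightarrow> nat \<Rightarrow> nat \<Rightarrow> nat list \<Rightarrow> nat" where
  "min_cuts k t m xs = (LEAST n. \<exists>C. fair k t m xs C \<and> card C = n)"

text \<open>Since \<open>log 2 0 = 0\<close>, this yields the usual values \<open>0\<close> at \<open>x = 0\<close> and \<open>x = 1\<close>.\<close>

definition binary_entropy :: "real \<Rightarrow> real" where
  "binary_entropy x = - x * log 2 x - (1 - x) * log 2 (1 - x)"

definition inv_binary_entropy :: "real \<Rightarrow> real" where
  "inv_binary_entropy = the_inv_into {0..1/2} binary_entropy"

lemma finite_necklaces: "finite (necklaces k t m)"
proof (rule finite_subset)
  show "necklaces k t m \<subseteq> {xs. set xs \<subseteq> {..<t} \<and> length xs = k * t * m}"
    by (auto simp: necklaces_def)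
qed (simp add: finite_lists_length_eq)

lemma necklaces_nonempty: "necklaces k t m \<noteq> {}"
proof -
  define ys where "ys t = concat (map (replicate (k * m)) [0..<t])" for t :: nat
  have "length (ys t) = k * t * m \<and> set (ys t) \<subseteq> {..<t} \<and>
      (\<forall>i. count_list (ys t) i = (if i < t then k * m else 0))"
  proof (induction t)
    case (Suc t)
    have "count_list (replicate n x) y = (if x = y then n else 0)" for n and x y :: nat
      by (induction n) auto
    with Suc show ?case
      by (auto simp: ys_def algebra_simps split: if_splits)
  qed (simp add: ys_def)
  then have "ys t \<in> necklaces k t m"
    by (simp add: necklaces_def)
  then show ?thesis
    by blast
qed

end

theory Submission
  imports Defs
begin

text \<open>
  A fair set of cuts amounts to a 2-colouring of the beads in which every type receives both
  colours, and its cost is the number of colour changes.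

  Upper bound: deleting both copies of the type of the first bead leaves a uniform necklace with
  \<open>t - 1\<close> types. Putting the pair back into an optimally coloured necklace with \<open>Y\<close> colour changes
  costs at most one new change, and this happens for at most \<open>t - Y / 2\<close> of the \<open>2 t - 1\<close> gaps.
  The drift \<open>1 / 2 - Y / (4 t)\<close> balances at \<open>Y = 0.4 t\<close>, and the second moment of the positive
  part of \<open>Y - 0.4 t\<close> stays below \<open>t\<close>, so Chebyshev's inequality applies.

  Lower bound: a first moment estimate. A fixed colouring is fair with probability at most
  \<open>2 t / 2 ^ t\<close>, and at most about \<open>2 ^ (2 H(q) t)\<close> colourings have at most \<open>2 q t\<close> changes, since
  the \<open>2 t\<close>-bead colourings satisfy \<open>(\<Sum>cs. x ^ changes cs) = 2 (1 + x) ^ (2 t - 1)\<close>, which is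
  used at \<open>x = q / (1 - q)\<close>.
\<close>

subsection \<open>Colourings\<close>

fun changes :: "'b list \<Rightarrow> nat" where
  "changes (a # b # cs) = of_bool (a \<noteq> b) + changes (b # cs)"
| "changes _ = 0"

definition colour_class :: "'b \<Rightarrow> 'a list \<Rightarrow> 'b list \<Rightarrow> 'a list" where
  "colour_class b xs cs = map fst (filter (\<lambda>z. snd z = b) (zip xs cs))"

text \<open>When every letter occurs twice, equality of the multisets says that each letter gets one
  bead of each colour. This form does not mention the alphabet.\<close>

definition fair_colouring :: "'a list \<Rightarrow> bool list \<Rightarrow> bool" where
  "fair_colouring xs cs \<longleftrightarrow> length cs = length xs \<and> mset (colour_class True xs cs) = mset (colour_class False xs cs)"

definition min_changes :: "'a list \<Rightarrow> nat" where
  "min_changes xs = (LEAST n. \<exists>cs. fair_colouring xs cs \<and> changes cs = n)"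

lemma changes_append:
  "changes (us @ vs) =
     changes us + changes vs + of_bool (us \<noteq> [] \<and> vs \<noteq> [] \<and> last us \<noteq> hd vs)"
  by (induction us rule: changes.induct) (cases vs; simp)+

lemma changes_eq_card: "changes cs = card {p. Suc p < length cs \<and> cs ! p \<noteq> cs ! Suc p}"
proof (induction cs rule: changes.induct)
  case (1 a b cs)
  let ?A = "{p. Suc p < length (b # cs) \<and> (b # cs) ! p \<noteq> (b # cs) ! Suc p}"
  have "{p. Suc p < length (a # b # cs) \<and> (a # b # cs) ! p \<noteq> (a # b # cs) ! Suc p}
        = (if a \<noteq> b then {0} else {}) \<union> Suc ` ?A" (is "?L = ?R")
  proof (rule set_eqI)
    show "p \<in> ?L \<longleftrightarrow> p \<in> ?R" for p
      by (cases p) auto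
  qed
  moreover have "finite ?A"
    by (rule finite_subset[of _ "{..length (b # cs)}"]) auto
  ultimately show ?case
    using 1 by (simp add: card_image card_insert_if)
qed auto

lemma colour_class_append:
  "length xs = length cs \<Longrightarrow> colour_class b (xs @ ys) (cs @ ds) = colour_class b xs cs @ colour_class b ys ds"
  by (simp add: colour_class_def)

lemma colour_class_Nil [simp]: "colour_class b [] cs = []"
  by (simp add: colour_class_def)

lemma colour_class_Cons [simp]:
  "colour_class b (x # xs) (c # cs) = (if c = b then x # colour_class b xs cs else colour_class b xs cs)"
  by (simp add: colour_class_def)

lemma mset_colour_class:
  "length xs = length cs \<Longrightarrow> mset (colour_class True xs cs) + mset (colour_class False xs cs) = mset xs"
  by (induction xs cs rule: list_induct2) auto

lemma length_colour_class: "length xs = length cs \<Longrightarrow> length (colour_class b xs cs) = count_list cs b"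
  by (induction xs cs rule: list_induct2) auto

lemma count_colour_class:
  assumes "length xs = length cs"
  shows "count (mset (colour_class b xs cs)) i = card {p. p < length xs \<and> cs ! p = b \<and> xs ! p = i}"
proof -
  have "count (mset (colour_class b xs cs)) i = length (filter (\<lambda>z. snd z = b \<and> fst z = i) (zip xs cs))"
    using assms by (induction xs cs rule: list_induct2) auto
  also have "\<dots> = card {p. p < length xs \<and> cs ! p = b \<and> xs ! p = i}"
    unfolding length_filter_conv_card using assms by (intro arg_cong[of _ _ card]) auto
  finally show ?thesis .
qed

text \<open>Both colour classes have the same size, so each is exactly half of the beads. This turns
  \<open>sum_costly\<close> into a bound in terms of the length and \<open>changes\<close>
  alone.\<close>

lemma length_fair_colouring:
  assumes "fair_colouring xs cs"
  shows "2 * count_list cs b = length xs"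
proof -
  have len: "length xs = length cs" and "mset (colour_class True xs cs) = mset (colour_class False xs cs)"
    using assms by (auto simp: fair_colouring_def)
  then have "count_list cs True = count_list cs False"
    using length_colour_class[OF len] by (metis size_mset)
  moreover have "count_list cs True + count_list cs False = length xs"
    using arg_cong[OF mset_colour_class[OF len], of size] length_colour_class[OF len] by simp
  ultimately show ?thesis
    by (cases b) auto
qed

lemma min_changes_le: "fair_colouring xs cs \<Longrightarrow> min_changes xs \<le> changes cs"
  unfolding min_changes_def by (rule Least_le) blast

lemma min_changes_attained:
  assumes "fair_colouring xs cs0"
  obtains cs where "fair_colouring xs cs" "changes cs = min_changes xs"
  using LeastI[of "\<lambda>n. \<exists>cs. fair_colouring xs cs \<and> changes cs = n" "changes cs0"] assms
  unfolding min_changes_def by blast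

subsection \<open>Inserting one pair of beads\<close>

definition insert_pair :: "'a \<Rightarrow> 'a list \<Rightarrow> nat \<Rightarrow> 'a list" where
  "insert_pair x w g = x # take g w @ x # drop g w"

text \<open>
  The gap \<open>g\<close> is costly if both of its sides carry the colour \<open>c\<close> of the first bead of the
  coloured necklace \<open>cs\<close>, where the new front bead counts as the left side of gap \<open>0\<close> and the
  missing right side of the last gap counts as \<open>c\<close>. At all other gaps, the second bead of a new
  pair can be given the colour other than \<open>c\<close> for free.
\<close>

definition costly :: "'b \<Rightarrow> 'b \<Rightarrow> 'b list \<Rightarrow> nat \<Rightarrow> bool" where
  "costly c b cs g \<longleftrightarrow> last (b # take g cs) = c \<and> (drop g cs = [] \<or> hd (drop g cs) = c)"

text \<open>Each bead of colour \<open>c\<close> in \<open>b # cs\<close> is the left side of one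
  gap, which is costly unless the colour changes away from \<open>c\<close> there. Changes away from
  \<open>c\<close> and back to it alternate, so \<open>changes (b # cs)\<close> is at most twice the
  number of changes away from \<open>c\<close>, plus one if \<open>b\<close> differs from
  \<open>c\<close>.\<close>

lemma sum_costly:
  fixes b c :: bool
  shows "2 * (\<Sum>g\<le>length cs. of_bool (costly c b cs g)) + changes (b # cs)
           \<le> 2 * count_list (b # cs) c + of_bool (b \<noteq> c)"
proof (induction cs arbitrary: b)
  case Nil
  then show ?case by (simp add: costly_def)
next
  case (Cons a cs)
  have "costly c b (a # cs) 0 \<longleftrightarrow> b = c \<and> a = c"
       "costly c b (a # cs) (Suc g) \<longleftrightarrow> costly c a cs g" for g
    by (auto simp: costly_def)
  then have "(\<Sum>g\<le>length (a # cs). of_bool (costly c b (a # cs) g) :: nat)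
      = of_bool (b = c \<and> a = c) + (\<Sum>g\<le>length cs. of_bool (costly c a cs g))"
    by (simp only: length_Cons sum.atMost_Suc_shift)
  with Cons[of a] show ?case
    by (auto split: if_splits)
qed

lemma insert_pair_fair_colouring:
  assumes "fair_colouring w cs"
  shows "fair_colouring (insert_pair x w g) (b # take g cs @ (\<not> b) # drop g cs)"
proof -
  have len: "length w = length cs" and eq: "mset (colour_class True w cs) = mset (colour_class False w cs)"
    using assms by (auto simp: fair_colouring_def)
  have mset: "mset (colour_class d (insert_pair x w g) (b # take g cs @ (\<not> b) # drop g cs))
      = add_mset x (mset (colour_class d w cs))" for d
    using len colour_class_append[of "take g w" "take g cs" d "drop g w" "drop g cs"]
    by (cases b; cases d) (simp_all add: insert_pair_def colour_class_append)
  show ?thesis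
    unfolding fair_colouring_def mset eq using len by (simp add: insert_pair_def)
qed

text \<open>At a gap that is not stuck, the front bead copies the first colour \<open>c\<close> and
  its twin joins a neighbour of the other colour, so no change arises. At a stuck gap, the twin
  takes \<open>c\<close> for free and only the front bead can create a change.\<close>

lemma changes_insert_pair:
  fixes c :: bool and us vs :: "bool list"
  assumes "us @ vs = [] \<or> hd (us @ vs) = c"
  defines "stuck \<equiv> last (c # us) = c \<and> (vs = [] \<or> hd vs = c)"
  defines "b \<equiv> if stuck then \<not> c else c"
  shows "changes (b # us @ (\<not> b) # vs) \<le> changes (us @ vs) + of_bool stuck"
proof -
  have Cons: "changes (a # ds) = changes ds + of_bool (ds \<noteq> [] \<and> a \<noteq> hd ds)" for a :: bool and ds
    by (cases ds) auto
  show ?thesis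
  proof (cases "us = []")
    case True
    then show ?thesis
      using assms(1) by (cases "vs = []") (auto simp: Cons b_def stuck_def)
  next
    case False
    then have "hd us = c"
      using assms(1) by auto
    with False show ?thesis
      by (cases "vs = []"; cases "last us = c") (auto simp: Cons changes_append b_def stuck_def)
  qed
qed

lemma min_changes_insert_pair_le:
  assumes "fair_colouring w cs" "cs = [] \<or> hd cs = c"
  shows "min_changes (insert_pair x w g) \<le> changes cs + of_bool (costly c c cs g)"
proof -
  define b where "b = (if costly c c cs g then \<not> c else c)"
  have "changes (b # take g cs @ (\<not> b) # drop g cs) \<le> changes cs + of_bool (costly c c cs g)"
    using changes_insert_pair[of "take g cs" "drop g cs" c] assms(2)
    by (simp add: b_def costly_def)
  with min_changes_le[OF insert_pair_fair_colouring[OF assms(1), of x g b]] show ?thesis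
    by linarith
qed

text \<open>\<open>\<delta>\<close> is the indicator of the costly gaps of one optimal colouring of
  \<open>w\<close>, so it is independent of the inserted letter. The last inequality provides the
  drift: many changes leave few costly gaps.\<close>

lemma sum_min_changes_insert_pair:
  assumes "fair_colouring w cs0"
  obtains \<delta> :: "nat \<Rightarrow> nat"
  where "\<And>g. \<delta> g \<le> 1"
    and "\<And>x g. g \<le> length w \<Longrightarrow> min_changes (insert_pair x w g) \<le> min_changes w + \<delta> g"
    and "2 * (\<Sum>g\<le>length w. \<delta> g) + min_changes w \<le> length w + 2"
proof -
  obtain cs where cs: "fair_colouring w cs" "changes cs = min_changes w"
    using min_changes_attained[OF assms] .
  \<comment> \<open>With this choice, the extra bead in front of \<open>c # cs\<close> adds no
    change.\<close>
  define c where "c = hd cs"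
  have len: "length cs = length w"
    using cs(1) by (simp add: fair_colouring_def)
  have "changes (c # cs) = changes cs"
    unfolding c_def by (cases cs) auto
  then have "2 * (\<Sum>g\<le>length cs. of_bool (costly c c cs g)) + changes cs \<le> length w + 2"
    using sum_costly[of c c cs] length_fair_colouring[OF cs(1), of c] by simp
  moreover have "g \<le> length w \<Longrightarrow>
      min_changes (insert_pair x w g) \<le> min_changes w + of_bool (costly c c cs g)" for x :: 'a and g
    using min_changes_insert_pair_le[OF cs(1), of c x g] cs(2) by (simp add: c_def)
  ultimately show ?thesis
    using that[of "\<lambda>g. of_bool (costly c c cs g)"] cs(2) len by simp
qed

subsection \<open>Words in which every letter occurs twice\<close>

text \<open>A general letter set in place of \<open>{..<t}\<close> lets inductions delete an
  arbitrary letter.\<close>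

definition double_words :: "'a set \<Rightarrow> 'a list set" where
  "double_words S = permutations_of_multiset (mset_set S + mset_set S)"

lemma finite_double_words [simp]: "finite (double_words S)"
  by (simp add: double_words_def)

lemma mset_double_words: "xs \<in> double_words S \<longleftrightarrow> mset xs = mset_set S + mset_set S"
  by (simp add: double_words_def permutations_of_multiset_def)

lemma length_double_words: "xs \<in> double_words S \<Longrightarrow> length xs = 2 * card S"
  by (metis mset_double_words size_mset size_union size_mset_set mult_2)

lemma set_double_words: "finite S \<Longrightarrow> xs \<in> double_words S \<Longrightarrow> set xs = S"
  by (metis mset_double_words set_mset_mset set_mset_union finite_set_mset_mset_set sup.idem)

lemma necklaces_eq_double_words: "necklaces 2 t 1 = double_words {..<t}"
proof (intro set_eqI iffI)
  fix xs assume xs: "xs \<in> necklaces 2 t 1"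
  have "count (mset xs) i = count (mset_set {..<t} + mset_set {..<t}) i" for i
    using xs by (cases "i < t")
      (auto simp: necklaces_def count_mset count_list_0_iff)
  then show "xs \<in> double_words {..<t}"
    by (auto simp: mset_double_words intro: multiset_eqI)
next
  fix xs assume xs: "xs \<in> double_words {..<t}"
  then have "mset xs = mset_set {..<t} + mset_set {..<t}"
    by (simp add: mset_double_words)
  then have "count_list xs i = 2" if "i < t" for i
    using that by (metis count_mset count_union count_mset_set(1) finite_lessThan lessThan_iff one_add_one)
  with xs show "xs \<in> necklaces 2 t 1"
    using length_double_words[OF xs] set_double_words[OF _ xs] by (auto simp: necklaces_def)
qed

text \<open>The first bead determines \<open>x\<close>, the place of its only other copy determines
  \<open>g\<close>, and deleting both leaves a word over the other letters.\<close>

lemma bij_betw_insert_pair: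
  assumes "finite S" "S \<noteq> {}"
  shows "bij_betw (\<lambda>(x, w, g). insert_pair x w g)
           (SIGMA x:S. SIGMA w:double_words (S - {x}). {..length w}) (double_words S)"
    (is "bij_betw ?i ?T _")
proof -
  let ?j = "\<lambda>xs. (hd xs, remove1 (hd xs) (tl xs), length (takeWhile (\<lambda>y. y \<noteq> hd xs) (tl xs)))"
  have ms: "mset_set S = add_mset x (mset_set (S - {x}))" if "x \<in> S" for x
    using that assms by (simp add: mset_set.remove)
  have *: "?i (?j xs) = xs \<and> ?j xs \<in> ?T" if xs_in: "xs \<in> double_words S" for xs
  proof -
    have mset: "mset xs = mset_set S + mset_set S"
      using xs_in by (simp add: mset_double_words)
    then obtain x ys where xs: "xs = x # ys"
      using assms by (cases xs) (auto simp: mset_set_empty_iff)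
    have "x \<in> S"
      using set_double_words[OF assms(1) xs_in] xs by auto
    then have ys: "mset ys = add_mset x (mset_set (S - {x}) + mset_set (S - {x}))"
      using mset ms[of x] by (simp add: xs)
    then have "x \<in> set ys"
      by (metis set_mset_mset union_single_eq_member)
    then obtain us vs where us: "ys = us @ x # vs" "x \<notin> set us"
      by (metis split_list_first)
    have "remove1 x ys = us @ vs" "takeWhile (\<lambda>y. y \<noteq> x) ys = us"
      using us by (auto simp: remove1_append takeWhile_tail)
    then show ?thesis
      using us ys \<open>x \<in> S\<close> by (simp add: xs insert_pair_def mset_double_words)
  qed
  have **: "?j (?i z) = z \<and> ?i z \<in> double_words S" if z_in: "z \<in> ?T" for z
  proof -
    obtain x w g where z: "z = (x, w, g)" "x \<in> S" "w \<in> double_words (S - {x})" "g \<le> length w"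
      using z_in by (cases z) auto
    have x: "x \<notin> set w"
      using set_double_words[OF _ z(3)] assms(1) by auto
    have x: "x \<notin> set (take g w)" "x \<notin> set (drop g w)"
      using x by (auto dest: in_set_takeD in_set_dropD)
    have tw: "takeWhile (\<lambda>y. y \<noteq> x) (take g w) = take g w"
      using x(1) by (subst takeWhile_eq_all_conv) auto
    have "mset (take g w) + mset (drop g w) = mset w"
      by (metis append_take_drop_id mset_append)
    then show ?thesis
      using x tw z(1,3,4) ms[OF z(2)]
      by (simp add: insert_pair_def remove1_append takeWhile_tail mset_double_words)
  qed
  show ?thesis
    by (rule bij_betw_byWitness[where f' = ?j]) (use * ** in blast)+
qed

text \<open>This is the counting form of the random process: the first letter, the remaining word
  and the gap of the twin are uniform, without conditional expectations.\<close>

lemma sum_double_words: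
  fixes f :: "'a list \<Rightarrow> 'c :: comm_monoid_add"
  assumes "finite S" "S \<noteq> {}"
  shows "(\<Sum>xs\<in>double_words S. f xs)
       = (\<Sum>x\<in>S. \<Sum>w\<in>double_words (S - {x}). \<Sum>g\<le>length w. f (insert_pair x w g))"
  unfolding sum.reindex_bij_betw[OF bij_betw_insert_pair[OF assms], symmetric]
  using assms(1) by (simp add: sum.Sigma case_prod_unfold)

text \<open>The word is built up pair by pair, and each pair gets opposite colours. Hence the
  \<open>LEAST\<close> in \<open>min_changes\<close> is attained.\<close>

lemma fair_colouring_exists:
  assumes "finite S" "xs \<in> double_words S"
  shows "\<exists>cs. fair_colouring xs cs"
  using assms
proof (induction "card S" arbitrary: S xs)
  case 0
  then have "xs = []"
    by (simp add: double_words_def)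
  then have "fair_colouring xs []"
    by (simp add: fair_colouring_def)
  then show ?case ..
next
  case (Suc n)
  then have "S \<noteq> {}"
    by auto
  from bij_betw_imp_surj_on[OF bij_betw_insert_pair[OF Suc.prems(1) this]] Suc.prems(2)
  have "xs \<in> (\<lambda>(x, w, g). insert_pair x w g) ` (SIGMA x:S. SIGMA w:double_words (S - {x}). {..length w})"
    by blast
  then obtain x w g where x: "x \<in> S" "w \<in> double_words (S - {x})" and xs: "xs = insert_pair x w g"
    by auto
  have "n = card (S - {x})"
    using Suc x by simp
  from Suc.hyps(1)[OF this _ x(2)] obtain cs where "fair_colouring w cs"
    using Suc.prems(1) by auto
  from insert_pair_fair_colouring[OF this] show ?case
    unfolding xs by blast
qed

lemma mset_colour_class_double_words:
  assumes "xs \<in> double_words S" "fair_colouring xs cs"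
  shows "mset (colour_class b xs cs) = mset_set S"
proof (rule multiset_eqI)
  fix i
  have "mset (colour_class True xs cs) = mset (colour_class False xs cs)"
    and len: "length xs = length cs"
    using assms(2) by (auto simp: fair_colouring_def)
  moreover have "mset (colour_class True xs cs) + mset (colour_class False xs cs) = mset_set S + mset_set S"
    using mset_colour_class[OF len] assms(1) by (simp add: mset_double_words)
  ultimately have "2 * count (mset (colour_class b xs cs)) i = 2 * count (mset_set S) i"
    by (metis (full_types) count_union mult_2)
  then show "count (mset (colour_class b xs cs)) i = count (mset_set S) i"
    by simp
qed

lemma card_double_words:
  assumes "finite S"
  shows "card (double_words S) * 2 ^ card S = fact (2 * card S)"
proof -
  have "(\<Prod>x\<in>S. fact (count (mset_set S + mset_set S) x) :: nat) = 2 ^ card S"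
    using assms by (simp add: numeral_2_eq_2)
  with card_permutations_of_multiset_aux[of "mset_set S + mset_set S"] assms show ?thesis
    by (simp add: double_words_def mult_2)
qed

subsection \<open>Cuts and colour changes\<close>

lemma interval_of_Suc:
  assumes "finite C"
  shows "interval_of C (Suc p) = interval_of C p + of_bool (Suc p \<in> C)"
proof -
  have "{c \<in> C. c \<le> Suc p} = (if Suc p \<in> C then {Suc p} else {}) \<union> {c \<in> C. c \<le> p}"
    by (auto simp: le_Suc_eq)
  moreover have "finite {c \<in> C. c \<le> p}" "Suc p \<notin> {c \<in> C. c \<le> p}"
    using assms by auto
  ultimately show ?thesis
    unfolding interval_of_def by simp
qed

text \<open>Cutting exactly at the colour changes makes the colours of the intervals alternate, so
  the parity of its interval number determines the colour of a bead.\<close>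

lemma fair_if_fair_colouring:
  assumes xs: "xs \<in> double_words {..<t}" and cs: "fair_colouring xs cs"
  shows "\<exists>C. fair 2 t 1 xs C \<and> card C = changes cs"
proof -
  have len: "length xs = length cs"
    using cs by (simp add: fair_colouring_def)
  define C where "C = Suc ` {p. Suc p < length cs \<and> cs ! p \<noteq> cs ! Suc p}"
  have sub: "C \<subseteq> {1..<length xs}"
    by (auto simp: C_def len)
  then have fin: "finite C"
    by (rule finite_subset) simp
  have card: "card C = changes cs"
    by (simp add: C_def card_image changes_eq_card)
  \<comment> \<open>Collection \<open>0\<close> receives the beads coloured \<open>True\<close>,
    collection \<open>1\<close> the others.\<close>
  define f :: "nat \<Rightarrow> nat" where "f j = of_bool (cs ! 0 \<noteq> even j)" for j
  have parity: "p < length cs \<Longrightarrow> cs ! p \<longleftrightarrow> (cs ! 0 \<longleftrightarrow> even (interval_of C p))" for p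
  proof (induction p)
    case 0
    have "{c \<in> C. c \<le> 0} = {}"
      by (auto simp: C_def)
    then have "interval_of C 0 = 0"
      unfolding interval_of_def by simp
    then show ?case
      by simp
  next
    case (Suc p)
    have "Suc p \<in> C \<longleftrightarrow> cs ! p \<noteq> cs ! Suc p"
      using Suc.prems by (auto simp: C_def)
    with Suc show ?case
      by (auto simp: interval_of_Suc[OF fin])
  qed
  have "card {p. p < length xs \<and> f (interval_of C p) = a \<and> xs ! p = i} = 1" if "a < 2" "i < t" for a i
  proof -
    have "{p. p < length xs \<and> f (interval_of C p) = a \<and> xs ! p = i}
        = {p. p < length xs \<and> cs ! p = (a = 0) \<and> xs ! p = i}"
      using that(1) parity by (auto simp: f_def len less_2_cases_iff)
    then show ?thesis
      using count_colour_class[OF len, of "a = 0" i] mset_colour_class_double_words[OF xs cs, of "a = 0"] that(2)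
      by simp
  qed
  then have "fair 2 t 1 xs C"
    unfolding fair_def using sub by (intro conjI exI[of _ f]) (auto simp: f_def)
  with card show ?thesis
    by blast
qed

text \<open>Beads are coloured by their collection. The colour can change only at a cut, but
  neighbouring intervals may share a collection, hence only an inequality.\<close>

lemma fair_colouring_if_fair:
  assumes xs: "xs \<in> double_words {..<t}" and C: "fair 2 t 1 xs C"
  shows "\<exists>cs. fair_colouring xs cs \<and> changes cs \<le> card C"
proof -
  from C obtain f where sub: "C \<subseteq> {1..<length xs}"
    and f: "\<And>j. j \<le> card C \<Longrightarrow> f j < (2::nat)"
    and count: "\<And>a i. a < 2 \<Longrightarrow> i < t \<Longrightarrow>
        card {p. p < length xs \<and> f (interval_of C p) = a \<and> xs ! p = i} = 1"
    unfolding fair_def by blast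
  have fin: "finite C"
    using sub by (rule finite_subset) simp
  define cs where "cs = map (\<lambda>p. f (interval_of C p) = 0) [0..<length xs]"
  have len: "length xs = length cs"
    by (simp add: cs_def)
  have f2: "f (interval_of C p) = 1 \<longleftrightarrow> f (interval_of C p) \<noteq> 0" for p
  proof -
    have "interval_of C p \<le> card C"
      unfolding interval_of_def by (intro card_mono fin) auto
    from f[OF this] show ?thesis
      by auto
  qed
  have "count (mset (colour_class b xs cs)) i = of_bool (i < t)" for b i
  proof (cases "i < t")
    case True
    have "cs ! p = b \<longleftrightarrow> f (interval_of C p) = (if b then 0 else 1)" if "p < length xs" for p
      using that f2[of p] by (cases b) (simp_all add: cs_def)
    then have "{p. p < length xs \<and> cs ! p = b \<and> xs ! p = i}
        = {p. p < length xs \<and> f (interval_of C p) = (if b then 0 else 1) \<and> xs ! p = i}"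
      by blast
    then show ?thesis
      using True count[of "if b then 0 else 1" i] by (simp add: count_colour_class[OF len])
  next
    case False
    then have "i \<notin> set xs"
      using set_double_words[OF _ xs] by simp
    then have "{p. p < length xs \<and> cs ! p = b \<and> xs ! p = i} = {}"
      by auto
    then show ?thesis
      using False by (simp add: count_colour_class[OF len])
  qed
  then have "fair_colouring xs cs"
    by (auto simp: fair_colouring_def len intro: multiset_eqI)
  moreover have "changes cs \<le> card C"
    unfolding changes_eq_card
  proof (rule card_inj_on_le[of Suc])
    have "Suc p \<in> C" if "Suc p < length cs" "cs ! p \<noteq> cs ! Suc p" for p
    proof (rule ccontr)
      assume "Suc p \<notin> C"
      then have "interval_of C (Suc p) = interval_of C p"
        by (simp add: interval_of_Suc[OF fin])
      with that show False
        by (simp add: cs_def nth_append del: upt_Suc)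
    qed
    then show "Suc ` {p. Suc p < length cs \<and> cs ! p \<noteq> cs ! Suc p} \<subseteq> C"
      by blast
  qed (use fin in auto)
  ultimately show ?thesis
    by blast
qed

lemma min_cuts_eq_min_changes:
  assumes "xs \<in> double_words {..<t}"
  shows "min_cuts 2 t 1 xs = min_changes xs"
proof (rule antisym)
  obtain cs where cs: "fair_colouring xs cs" "changes cs = min_changes xs"
    using fair_colouring_exists[OF _ assms] min_changes_attained by (metis finite_lessThan)
  obtain C where C: "fair 2 t 1 xs C" "card C = min_changes xs"
    using fair_if_fair_colouring[OF assms cs(1)] cs(2) by auto
  then show "min_cuts 2 t 1 xs \<le> min_changes xs"
    unfolding min_cuts_def by (intro Least_le) blast
  have "\<exists>C. fair 2 t 1 xs C \<and> card C = min_cuts 2 t 1 xs"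
    unfolding min_cuts_def by (rule LeastI[of "\<lambda>n. \<exists>C. fair 2 t 1 xs C \<and> card C = n" "card C"]) (use C in blast)
  then obtain D where D: "fair 2 t 1 xs D" "card D = min_cuts 2 t 1 xs"
    by blast
  show "min_changes xs \<le> min_cuts 2 t 1 xs"
    using fair_colouring_if_fair[OF assms D(1)] D(2) min_changes_le by fastforce
qed

subsection \<open>The upper bound\<close>

text \<open>For \<open>z \<ge> 0\<close> the right side is \<open>(z + d)^2\<close>; for
  \<open>z < 0\<close> it is \<open>d^2\<close>, and \<open>z + d < d\<close>. Being linear in
  \<open>d\<close> up to \<open>d^2\<close>, the bound can be averaged over the gaps.\<close>

lemma pos_part_square_add:
  fixes z d :: real
  shows "(max 0 (z + d))\<^sup>2 \<le> (max 0 z)\<^sup>2 + 2 * max 0 z * d + d\<^sup>2"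
proof (cases "0 \<le> z")
  case True
  then have "(max 0 z)\<^sup>2 + 2 * max 0 z * d + d\<^sup>2 = (z + d)\<^sup>2"
    by (simp add: power2_sum)
  then show ?thesis
    by (simp add: max_def)
next
  case False
  then show ?thesis
    by (cases "0 \<le> z + d") (auto simp: max_def intro: power_mono)
qed

text \<open>
  If the number of changes exceeds \<open>0.4 (n - 1)\<close> by \<open>z > 0\<close>, then inserting the \<open>n\<close>-th pair at a
  random gap raises the excess on average by at most \<open>(0.6 - z / 2) / (2 n - 1)\<close>. Since this
  restoring drift is negative for large \<open>z\<close>, the mean squared excess grows by at most \<open>1\<close>.
\<close>

lemma sum_excess_insert_pair_le:
  fixes w :: "'a list" and n :: real
  assumes "fair_colouring w cs" "real (length w) = 2 * n - 2" "n \<ge> 1"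
  shows "(\<Sum>g\<le>length w. (max 0 (real (min_changes (insert_pair x w g)) - 2 / 5 * n))\<^sup>2)
           \<le> (2 * n - 1) * ((max 0 (real (min_changes w) - 2 / 5 * (n - 1)))\<^sup>2 + 1)"
proof -
  obtain \<delta> :: "nat \<Rightarrow> nat" where \<delta>: "\<And>g. \<delta> g \<le> 1"
      "\<And>g. g \<le> length w \<Longrightarrow> min_changes (insert_pair x w g) \<le> min_changes w + \<delta> g"
      "2 * (\<Sum>g\<le>length w. \<delta> g) + min_changes w \<le> length w + 2"
    using sum_min_changes_insert_pair[OF assms(1)] by metis
  define z where "z = real (min_changes w) - 2 / 5 * (n - 1)"
  define s where "s = (\<Sum>g\<le>length w. real (\<delta> g))"
  have card: "real (card {..length w}) = 2 * n - 1"
    using assms(2) by simp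
  have "real (2 * (\<Sum>g\<le>length w. \<delta> g) + min_changes w) \<le> real (length w + 2)"
    using \<delta>(3) by (rule of_nat_mono)
  then have "2 * s + real (min_changes w) \<le> 2 * n"
    using assms(2) by (simp add: s_def)
  \<comment> \<open>The level \<open>2 / 5\<close> is the one at which the terms in \<open>n\<close>
    cancel: a level \<open>a\<close> requires \<open>n - a * n / 2 = 2 * a * n\<close>.\<close>
  then have s: "s - 2 / 5 * (2 * n - 1) \<le> 3 / 5 - z / 2"
    by (simp add: z_def field_simps)
  have "(max 0 (real (min_changes (insert_pair x w g)) - 2 / 5 * n))\<^sup>2
      \<le> (max 0 z)\<^sup>2 + 2 * max 0 z * (real (\<delta> g) - 2 / 5) + 9 / 25" if "g \<le> length w" for g
  proof -
    have "real (min_changes (insert_pair x w g)) \<le> real (min_changes w) + real (\<delta> g)"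
      using \<delta>(2)[OF that] by linarith
    then have "(max 0 (real (min_changes (insert_pair x w g)) - 2 / 5 * n))\<^sup>2
        \<le> (max 0 (z + (real (\<delta> g) - 2 / 5)))\<^sup>2"
      by (intro power_mono max.mono) (auto simp: z_def field_simps)
    also have "\<dots> \<le> (max 0 z)\<^sup>2 + 2 * max 0 z * (real (\<delta> g) - 2 / 5) + (real (\<delta> g) - 2 / 5)\<^sup>2"
      by (rule pos_part_square_add)
    also have "(real (\<delta> g) - 2 / 5)\<^sup>2 \<le> 9 / 25"
    proof -
      have "\<delta> g = 0 \<or> \<delta> g = 1"
        using \<delta>(1)[of g] by linarith
      then show ?thesis
        by (auto simp: power2_eq_square)
    qed
    finally show ?thesis
      by simp
  qed
  then have "(\<Sum>g\<le>length w. (max 0 (real (min_changes (insert_pair x w g)) - 2 / 5 * n))\<^sup>2)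
      \<le> (\<Sum>g\<le>length w. (max 0 z)\<^sup>2 + 2 * max 0 z * (real (\<delta> g) - 2 / 5) + 9 / 25)"
    by (intro sum_mono) auto
  also have "\<dots> = (2 * n - 1) * ((max 0 z)\<^sup>2 + 9 / 25) + 2 * max 0 z * (s - 2 / 5 * (2 * n - 1))"
    by (simp only: sum.distrib sum_distrib_left[symmetric] sum_subtractf sum_constant card s_def)
      (simp add: algebra_simps)
  also have "2 * max 0 z * (s - 2 / 5 * (2 * n - 1)) \<le> 2 * max 0 z * (3 / 5 - z / 2)"
    using s by (intro mult_left_mono) auto
  \<comment> \<open>For \<open>z \<ge> 0\<close> this quadratic attains its maximum
    \<open>9 / 25\<close> at \<open>z = 3 / 5\<close>.\<close>
  also have "2 * max 0 z * (3 / 5 - z / 2) \<le> 9 / 25"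
  proof (cases "0 \<le> z")
    case True
    have "0 \<le> (z - 3 / 5)\<^sup>2"
      by simp
    also have "\<dots> = 9 / 25 - 2 * z * (3 / 5 - z / 2)"
      by (simp add: power2_eq_square field_simps)
    finally show ?thesis
      using True by simp
  qed (simp add: max_def)
  finally have "(\<Sum>g\<le>length w. (max 0 (real (min_changes (insert_pair x w g)) - 2 / 5 * n))\<^sup>2)
      \<le> (2 * n - 1) * ((max 0 z)\<^sup>2 + 9 / 25) + 9 / 25"
    by simp
  \<comment> \<open>The remaining \<open>9 / 25\<close> is absorbed since
    \<open>2 * n - 1 \<ge> 1\<close>; the constants then add up to \<open>1\<close>.\<close>
  also have "\<dots> \<le> (2 * n - 1) * ((max 0 z)\<^sup>2 + 9 / 25) + (2 * n - 1) * (16 / 25)"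
    using assms(3) by simp
  also have "\<dots> = (2 * n - 1) * ((max 0 z)\<^sup>2 + 1)"
    by (subst distrib_left[symmetric]) simp
  finally show ?thesis
    by (simp add: z_def)
qed

text \<open>The mean squared excess starts at \<open>0\<close> for the empty word and grows by at
  most \<open>1\<close> per pair. The bound is multiplied by the number of words to avoid
  quotients.\<close>

lemma sum_excess_le:
  assumes "finite S"
  shows "(\<Sum>xs\<in>double_words S. (max 0 (real (min_changes xs) - 2 / 5 * real (card S)))\<^sup>2)
           \<le> real (card S) * real (card (double_words S))"
  using assms
proof (induction "card S" arbitrary: S)
  case 0
  have "min_changes ([] :: 'a list) = 0"
    using min_changes_le[of "[] :: 'a list" "[]"] by (simp add: fair_colouring_def)
  with 0 show ?case
    by (simp add: double_words_def)
next
  case (Suc m)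
  let ?e = "\<lambda>n xs. (max 0 (real (min_changes xs) - 2 / 5 * n))\<^sup>2"
  define n where "n = real (card S)"
  have ne: "S \<noteq> {}" and n1: "n \<ge> 1"
    using Suc.hyps(2) by (auto simp: n_def)
  have card: "card (S - {x}) = m" "real (card (S - {x})) = n - 1" if "x \<in> S" for x
    using Suc.hyps(2) that Suc.prems by (auto simp: n_def)
  have len: "real (length w) = 2 * n - 2" if "x \<in> S" "w \<in> double_words (S - {x})" for x w
    using length_double_words[OF that(2)] card[OF that(1)] by simp
  have step: "(\<Sum>w\<in>double_words (S - {x}). \<Sum>g\<le>length w. ?e n (insert_pair x w g))
      \<le> n * (\<Sum>w\<in>double_words (S - {x}). \<Sum>g\<le>length w. 1)" if "x \<in> S" for x
  proof -
    let ?W = "double_words (S - {x})"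
    have "(\<Sum>w\<in>?W. \<Sum>g\<le>length w. ?e n (insert_pair x w g))
        \<le> (\<Sum>w\<in>?W. (2 * n - 1) * (?e (n - 1) w + 1))"
    proof (rule sum_mono)
      fix w assume w: "w \<in> ?W"
      obtain cs where "fair_colouring w cs"
        using fair_colouring_exists[OF _ w] Suc.prems by blast
      from sum_excess_insert_pair_le[OF this len[OF that w] n1]
      show "(\<Sum>g\<le>length w. ?e n (insert_pair x w g)) \<le> (2 * n - 1) * (?e (n - 1) w + 1)" .
    qed
    also have "\<dots> = (2 * n - 1) * ((\<Sum>w\<in>?W. ?e (n - 1) w) + real (card ?W))"
      by (simp add: sum_distrib_left[symmetric] sum.distrib)
    also have "(\<Sum>w\<in>?W. ?e (n - 1) w) \<le> (n - 1) * real (card ?W)"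
      using Suc.hyps(1)[of "S - {x}"] card[OF that] Suc.prems by simp
    \<comment> \<open>Here \<open>2 * n - 1\<close> is the number of gaps, so the sum becomes a
      count of the pairs of a word and a gap. Below, \<open>sum_double_words\<close> for the
      constant \<open>1\<close> turns this count back into the number of double words.\<close>
    also have "(2 * n - 1) * ((n - 1) * real (card ?W) + real (card ?W))
        = n * (\<Sum>w\<in>?W. 2 * n - 1)"
      by (simp add: algebra_simps)
    also have "(\<Sum>w\<in>?W. 2 * n - 1) = (\<Sum>w\<in>?W. \<Sum>g\<le>length w. 1)"
      by (intro sum.cong refl) (use len[OF that] in simp)
    finally show ?thesis
      using n1 by (simp add: mult_left_mono)
  qed
  have "(\<Sum>xs\<in>double_words S. ?e n xs) \<le> (\<Sum>x\<in>S. n * (\<Sum>w\<in>double_words (S - {x}). \<Sum>g\<le>length w. 1))"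
    unfolding sum_double_words[OF Suc.prems ne] by (intro sum_mono step)
  also have "\<dots> = n * (\<Sum>xs\<in>double_words S. 1)"
    unfolding sum_double_words[OF Suc.prems ne] by (simp add: sum_distrib_left)
  finally show ?case
    by (simp add: n_def)
qed

text \<open>Chebyshev's inequality: every word counted contributes at least
  \<open>(\<epsilon> * n)^2\<close> to a sum that is at most \<open>n\<close> times the number of
  words, where \<open>n = card S\<close>.\<close>

lemma card_min_changes_gt:
  assumes "finite S" "S \<noteq> {}" "\<epsilon> > 0"
  shows "real (card {xs \<in> double_words S. real (min_changes xs) > (2 / 5 + \<epsilon>) * real (card S)})
           \<le> real (card (double_words S)) / (\<epsilon>\<^sup>2 * real (card S))"
proof -
  define n where "n = real (card S)"
  have n: "n > 0"
    using assms by (simp add: n_def card_gt_0_iff)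
  let ?B = "{xs \<in> double_words S. real (min_changes xs) > (2 / 5 + \<epsilon>) * n}"
  let ?e = "\<lambda>xs. (max 0 (real (min_changes xs) - 2 / 5 * n))\<^sup>2"
  have "real (card ?B) * (\<epsilon> * n)\<^sup>2 = (\<Sum>xs\<in>?B. (\<epsilon> * n)\<^sup>2)"
    by simp
  also have "\<dots> \<le> (\<Sum>xs\<in>?B. ?e xs)"
    using n assms(3) by (intro sum_mono power_mono) (auto simp: algebra_simps)
  also have "\<dots> \<le> (\<Sum>xs\<in>double_words S. ?e xs)"
    by (rule sum_mono2) auto
  also have "\<dots> \<le> n * real (card (double_words S))"
    unfolding n_def by (rule sum_excess_le[OF assms(1)])
  finally show ?thesis
    using n assms(3) by (simp add: field_simps power2_eq_square flip: n_def)
qed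

subsection \<open>The lower bound\<close>

lemma finite_lists_length: "finite {cs :: 'b :: finite list. length cs = n}"
  using finite_lists_length_eq[of "UNIV :: 'b set" n] by simp

text \<open>Of the two colours that can be put in front of a nonempty list, one keeps the number of
  changes and one adds a change, hence a factor \<open>1 + x\<close> per further bead. The factor
  \<open>2\<close> is the choice for a single bead.\<close>

lemma sum_power_changes:
  fixes x :: real
  shows "(\<Sum>cs :: bool list | length cs = Suc n. x ^ changes cs) = 2 * (1 + x) ^ n"
proof (induction n)
  case 0
  have "{cs :: bool list. length cs = Suc 0} = {[True], [False]}"
    by (auto simp: length_Suc_conv)
  then show ?case
    by simp
next
  case (Suc n)
  let ?L = "{cs :: bool list. length cs = Suc n}"
  have fin: "finite ?L"
    by (rule finite_lists_length)
  have L: "{cs :: bool list. length cs = Suc (Suc n)} = (#) True ` ?L \<union> (#) False ` ?L"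
    unfolding length_Suc_conv[of _ "Suc n"] by auto
  have "(\<Sum>cs :: bool list | length cs = Suc (Suc n). x ^ changes cs)
      = (\<Sum>cs\<in>?L. x ^ changes (True # cs)) + (\<Sum>cs\<in>?L. x ^ changes (False # cs))"
    unfolding L using fin by (subst sum.union_disjoint) (auto simp: sum.reindex)
  also have "\<dots> = (\<Sum>cs\<in>?L. x ^ changes (True # cs) + x ^ changes (False # cs))"
    by (simp add: sum.distrib)
  also have "\<dots> = (\<Sum>cs\<in>?L. (1 + x) * x ^ changes cs)"
  proof (rule sum.cong)
    fix cs assume "cs \<in> ?L"
    then obtain c ds where "cs = c # ds"
      by (auto simp: length_Suc_conv)
    then show "x ^ changes (True # cs) + x ^ changes (False # cs) = (1 + x) * x ^ changes cs"
      by (cases c) (auto simp: algebra_simps)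
  qed simp
  also have "\<dots> = 2 * (1 + x) ^ Suc n"
    by (simp add: Suc sum_distrib_left[symmetric])
  finally show ?case .
qed

text \<open>At each position \<open>cs\<close> tells which of the two classes supplies the next
  letter.\<close>

lemma colour_classes_inject:
  fixes cs :: "bool list"
  assumes "length xs = length cs" "length ys = length cs"
    and "\<And>b. colour_class b xs cs = colour_class b ys cs"
  shows "xs = ys"
  using assms
proof (induction cs arbitrary: xs ys)
  case (Cons c cs)
  obtain x xs' y ys' where xy: "xs = x # xs'" "ys = y # ys'"
    using Cons.prems by (metis length_Suc_conv length_Cons)
  have "x = y" and *: "colour_class c xs' cs = colour_class c ys' cs"
    using Cons.prems(3)[of c] by (simp_all add: xy)
  moreover have "colour_class (\<not> c) xs' cs = colour_class (\<not> c) ys' cs"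
    using Cons.prems(3)[of "\<not> c"] by (cases c) (simp_all add: xy)
  then have "colour_class b xs' cs = colour_class b ys' cs" for b
    using * by (cases "b = c") auto
  then have "xs' = ys'"
    using Cons.IH Cons.prems by (simp add: xy)
  ultimately show ?case
    by (simp add: xy)
qed auto

text \<open>A word for which \<open>cs\<close> is fair interleaves two permutations of
  \<open>S\<close> in the pattern prescribed by \<open>cs\<close>.\<close>

lemma card_fair_colouring_le:
  assumes "finite S"
  shows "card {xs \<in> double_words S. fair_colouring xs cs} \<le> (fact (card S))\<^sup>2"
proof -
  let ?F = "{xs \<in> double_words S. fair_colouring xs cs}"
  let ?P = "permutations_of_set S"
  have "card ?F \<le> card (?P \<times> ?P)"
  proof (rule card_inj_on_le)
    show "inj_on (\<lambda>xs. (colour_class True xs cs, colour_class False xs cs)) ?F"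
    proof (rule inj_onI, rule colour_classes_inject)
      fix xs ys b
      assume "xs \<in> ?F" "ys \<in> ?F" and
        eq: "(colour_class True xs cs, colour_class False xs cs) =
             (colour_class True ys cs, colour_class False ys cs)"
      then show "length xs = length cs" "length ys = length cs"
        by (auto simp: fair_colouring_def)
      show "colour_class b xs cs = colour_class b ys cs"
        using eq by (cases b) auto
    qed
    have "colour_class b xs cs \<in> ?P" if "xs \<in> ?F" for xs b
    proof -
      have "mset (colour_class b xs cs) = mset_set S"
        using mset_colour_class_double_words that by blast
      then show ?thesis
        using assms by (simp add: permutations_of_set_altdef permutations_of_multiset_def)
    qed
    then show "(\<lambda>xs. (colour_class True xs cs, colour_class False xs cs)) ` ?F \<subseteq> ?P \<times> ?P"
      by blast
  qed simp
  also have "card (?P \<times> ?P) = (fact (card S))\<^sup>2"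
    using assms by (simp add: card_cartesian_product power2_eq_square)
  finally show ?thesis .
qed

text \<open>A union bound over the colourings with at most \<open>r\<close> changes, which are
  counted in the exponential Markov style by the weights \<open>x ^ changes cs\<close>.\<close>

lemma card_min_changes_le:
  fixes x r :: real
  assumes "finite S" "S \<noteq> {}" "0 < x" "x \<le> 1"
  shows "real (card {xs \<in> double_words S. real (min_changes xs) \<le> r}) * x powr r
           \<le> (fact (card S))\<^sup>2 * (2 * (1 + x) ^ (2 * card S - 1))"
proof -
  let ?B = "{xs \<in> double_words S. real (min_changes xs) \<le> r}"
  let ?L = "{cs :: bool list. length cs = 2 * card S}"
  let ?C = "{cs \<in> ?L. real (changes cs) \<le> r}"
  let ?F = "\<lambda>cs. {xs \<in> double_words S. fair_colouring xs cs}"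
  have fin: "finite ?L"
    by (rule finite_lists_length)
  have "?B \<subseteq> (\<Union>cs\<in>?C. ?F cs)"
  proof
    fix xs assume xs: "xs \<in> ?B"
    then obtain cs where cs: "fair_colouring xs cs" "changes cs = min_changes xs"
      using fair_colouring_exists[OF assms(1)] min_changes_attained by (metis (lifting) mem_Collect_eq)
    then have "length cs = 2 * card S"
      using xs length_double_words[of xs S] by (simp add: fair_colouring_def)
    with xs cs show "xs \<in> (\<Union>cs\<in>?C. ?F cs)"
      by auto
  qed
  then have "card ?B \<le> card (\<Union>cs\<in>?C. ?F cs)"
    using fin by (intro card_mono) auto
  also have "\<dots> \<le> (\<Sum>cs\<in>?C. card (?F cs))"
    using fin by (intro card_UN_le) auto
  also have "\<dots> \<le> card ?C * (fact (card S))\<^sup>2"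
    using sum_mono[of ?C "\<lambda>cs. card (?F cs)" "\<lambda>_. (fact (card S))\<^sup>2"] card_fair_colouring_le[OF assms(1)]
    by simp
  finally have "real (card ?B) \<le> real (card ?C * (fact (card S))\<^sup>2)"
    by (rule of_nat_mono)
  then have B: "real (card ?B) \<le> real (card ?C) * (fact (card S))\<^sup>2"
    by (simp only: of_nat_mult of_nat_power of_nat_fact)
  have "real (card ?C) * x powr r = (\<Sum>cs\<in>?C. x powr r)"
    by simp
  \<comment> \<open>Since \<open>x \<le> 1\<close>, fewer changes mean a larger weight.\<close>
  also have "\<dots> \<le> (\<Sum>cs\<in>?C. x ^ changes cs)"
    using assms(3,4) by (intro sum_mono) (auto simp: powr_realpow[symmetric] intro: powr_mono')
  also have "\<dots> \<le> (\<Sum>cs\<in>?L. x ^ changes cs)"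
    using fin assms(3) by (intro sum_mono2) auto
  also have "\<dots> = 2 * (1 + x) ^ (2 * card S - 1)"
  proof -
    have "Suc (2 * card S - 1) = 2 * card S"
      using assms(1,2) by (simp add: card_gt_0_iff)
    then show ?thesis
      using sum_power_changes[of x "2 * card S - 1"] by simp
  qed
  finally have C: "real (card ?C) * x powr r \<le> 2 * (1 + x) ^ (2 * card S - 1)" .
  have "real (card ?B) * x powr r \<le> real (card ?C) * (fact (card S))\<^sup>2 * x powr r"
    by (intro mult_right_mono B) simp
  also have "\<dots> = (fact (card S))\<^sup>2 * (real (card ?C) * x powr r)"
    by (simp only: mult_ac)
  also have "\<dots> \<le> (fact (card S))\<^sup>2 * (2 * (1 + x) ^ (2 * card S - 1))"
    by (intro mult_left_mono C) simp
  finally show ?thesis .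
qed

text \<open>With \<open>n = card S\<close>, the number of words is
  \<open>(2 * n choose n) * (fact n)^2 / 2 ^ n\<close>, and the central binomial coefficient is at
  least \<open>4 ^ n / (2 * n)\<close>. So a fixed colouring is fair with probability at most
  \<open>2 * n / 2 ^ n\<close>.\<close>

lemma card_double_words_ge:
  assumes "finite S" "S \<noteq> {}"
  shows "(fact (card S))\<^sup>2 * 2 ^ card S \<le> real (card (double_words S)) * (2 * real (card S))"
proof -
  define n where "n = card S"
  have n: "n > 0"
    using assms by (simp add: n_def card_gt_0_iff)
  have "real ((2 * n) choose n) * (fact n)\<^sup>2 = fact (2 * n)"
    using binomial_fact[of n "2 * n", where 'a = real] by (simp add: power2_eq_square)
  also have "\<dots> = real (card (double_words S)) * 2 ^ n"
    using arg_cong[OF card_double_words[OF assms(1)], of real]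
    by (simp only: n_def of_nat_mult of_nat_power of_nat_fact of_nat_numeral)
  finally have eq: "real ((2 * n) choose n) * (fact n)\<^sup>2 = real (card (double_words S)) * 2 ^ n" .
  have "4 ^ n / (2 * real n) * (fact n)\<^sup>2 \<le> real ((2 * n) choose n) * (fact n)\<^sup>2"
    by (intro mult_right_mono central_binomial_lower_bound n) simp
  moreover have "(4 :: real) ^ n = 2 ^ n * 2 ^ n"
    by (simp flip: power_mult_distrib)
  ultimately have "2 ^ n * (2 ^ n * (fact n)\<^sup>2) \<le> 2 ^ n * (real (card (double_words S)) * (2 * real n))"
    using n unfolding eq by (simp add: divide_simps mult_ac)
  then show ?thesis
    by (simp add: n_def mult_ac)
qed

lemma powr_binary_entropy:
  assumes "0 < q" "q < 1"
  shows "2 powr binary_entropy q = q powr (- q) * (1 - q) powr (- (1 - q))"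
proof -
  have "2 powr (a * log 2 y) = y powr a" if "y > 0" for a y :: real
    using that by (metis mult.commute powr_powr powr_log_cancel zero_less_numeral numeral_eq_one_iff
        semiring_norm(85))
  moreover have "binary_entropy q = - q * log 2 q + - (1 - q) * log 2 (1 - q)"
    by (simp add: binary_entropy_def algebra_simps)
  ultimately show ?thesis
    using assms by (simp only: powr_add)
qed

text \<open>The number of colourings contributes \<open>2 powr (2 * binary_entropy q)\<close> per
  letter and fairness costs a factor \<open>2\<close>, so the critical \<open>q\<close> has entropy
  \<open>1 / 2\<close>.\<close>

lemma card_min_changes_le_entropy:
  assumes "finite S" "S \<noteq> {}" "0 < q" "q \<le> 1 / 2"
  shows "real (card {xs \<in> double_words S. real (min_changes xs) \<le> 2 * q * real (card S)})
           \<le> real (card (double_words S)) *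
              (4 * real (card S) * (2 powr (2 * binary_entropy q - 1)) ^ card S)"
proof -
  define n where "n = card S"
  \<comment> \<open>This value minimises \<open>(1 + x)^2 / x powr (2 * q)\<close>, and the minimum
    is \<open>2 powr (2 * binary_entropy q)\<close>. It is at most \<open>1\<close> because
    \<open>q \<le> 1 / 2\<close>.\<close>
  define x where "x = q / (1 - q)"
  define y where "y = x powr (2 * q * real n)"
  let ?B = "{xs \<in> double_words S. real (min_changes xs) \<le> 2 * q * real n}"
  have x: "0 < x" "x \<le> 1" "1 + x = 1 / (1 - q)"
    using assms by (auto simp: x_def field_simps)
  have y: "y > 0"
    using x by (simp add: y_def)
  have "(1 + x) ^ (2 * n) = y * (2 powr (2 * binary_entropy q)) ^ n"
  proof -
    have "(2 powr (2 * binary_entropy q)) ^ n = (2 powr binary_entropy q) powr (2 * real n)"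
      by (simp add: powr_powr powr_realpow[symmetric] mult_ac)
    also have "\<dots> = (q powr (- q) * (1 - q) powr (- (1 - q))) powr (2 * real n)"
      using assms by (simp add: powr_binary_entropy)
    finally have "ln (y * (2 powr (2 * binary_entropy q)) ^ n)
        = ln (x powr (2 * q * real n) * (q powr (- q) * (1 - q) powr (- (1 - q))) powr (2 * real n))"
      by (simp add: y_def)
    also have "\<dots> = 2 * real n * (- ln (1 - q))"
      using assms x(1) by (simp add: ln_mult ln_powr x_def ln_div algebra_simps)
    also have "\<dots> = ln ((1 + x) ^ (2 * n))"
      using assms by (simp add: x(3) ln_realpow ln_div)
    finally have "ln (y * (2 powr (2 * binary_entropy q)) ^ n) = ln ((1 + x) ^ (2 * n))" .
    moreover have "0 < y * (2 powr (2 * binary_entropy q)) ^ n" "0 < (1 + x) ^ (2 * n)"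
      using x(1) y by simp_all
    ultimately show ?thesis
      by (simp only: ln_inj_iff)
  qed
  moreover have "(1 + x) ^ (2 * n - 1) \<le> (1 + x) ^ (2 * n)"
    using x by (intro power_increasing) auto
  ultimately have "real (card ?B) * y \<le> (fact n)\<^sup>2 * (2 * (y * (2 powr (2 * binary_entropy q)) ^ n))"
    using card_min_changes_le[OF assms(1,2) x(1,2), of "2 * q * real n"]
    by (smt (verit) mult_left_mono n_def y_def zero_le_power2)
  then have "real (card ?B) * y \<le> (2 * (fact n)\<^sup>2 * (2 powr (2 * binary_entropy q)) ^ n) * y"
    by (simp add: mult_ac)
  then have "real (card ?B) \<le> 2 * (fact n)\<^sup>2 * (2 powr (2 * binary_entropy q)) ^ n"
    using y by simp
  \<comment> \<open>Splitting off \<open>2 ^ n\<close> prepares for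
    \<open>card_double_words_ge\<close>.\<close>
  also have "2 powr (2 * binary_entropy q) = 2 * 2 powr (2 * binary_entropy q - 1)"
    by (simp add: powr_diff)
  also have "2 * (fact n)\<^sup>2 * (2 * 2 powr (2 * binary_entropy q - 1)) ^ n
      = 2 * ((fact n)\<^sup>2 * 2 ^ n) * (2 powr (2 * binary_entropy q - 1)) ^ n"
    by (simp add: power_mult_distrib)
  also have "\<dots> \<le> 2 * (real (card (double_words S)) * (2 * real n)) * (2 powr (2 * binary_entropy q - 1)) ^ n"
    unfolding n_def by (intro mult_right_mono mult_left_mono card_double_words_ge assms) auto
  finally show ?thesis
    by (simp add: n_def mult_ac)
qed

subsection \<open>Inverting the binary entropy\<close>

lemma binary_entropy_strict_mono: "strict_mono_on {0..1 / 2} binary_entropy"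
proof (rule strict_mono_onI)
  fix x y :: real
  assume xy: "x \<in> {0..1 / 2}" "y \<in> {0..1 / 2}" "x < y"
  show "binary_entropy x < binary_entropy y"
  proof (cases "x = 0")
    case True
    have "y * log 2 y < 0" "(1 - y) * log 2 (1 - y) < 0"
      using xy True by (auto simp: mult_less_0_iff)
    then show ?thesis
      using True by (simp add: binary_entropy_def)
  next
    case False
    have deriv: "(binary_entropy has_real_derivative (log 2 (1 - u) - log 2 u)) (at u)"
      if "0 < u" "u < 1" for u
    proof -
      have "((\<lambda>x. - x * ln x - (1 - x) * ln (1 - x)) has_real_derivative (ln (1 - u) - ln u)) (at u)"
        using that by (auto intro!: derivative_eq_intros)
      from DERIV_cdivide[OF this, of "ln 2"]
      have "((\<lambda>x. (- x * ln x - (1 - x) * ln (1 - x)) / ln 2) has_real_derivative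
          (log 2 (1 - u) - log 2 u)) (at u)"
        by (simp only: log_def diff_divide_distrib)
      also have "(\<lambda>x. (- x * ln x - (1 - x) * ln (1 - x)) / ln 2) = binary_entropy"
        by (rule ext) (simp add: binary_entropy_def log_def diff_divide_distrib)
      finally show ?thesis .
    qed
    show ?thesis
    proof (rule DERIV_pos_imp_increasing_open[OF xy(3)])
      show "\<exists>d. (binary_entropy has_real_derivative d) (at u) \<and> 0 < d" if "x < u" "u < y" for u
        using deriv[of u] that xy False by (intro exI[of _ "log 2 (1 - u) - log 2 u"]) auto
      show "continuous_on {x..y} binary_entropy"
        using xy False by (intro continuous_at_imp_continuous_on ballI DERIV_isCont[OF deriv]) auto
    qed
  qed
qed

text \<open>At a rational point the entropy is a difference of logarithms of integers, so comparing
  it with a rational number reduces to comparing natural numbers exactly.\<close>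

lemma binary_entropy_nat:
  assumes "a > 0" "b > 0"
  shows "(real a + real b) * binary_entropy (real a / (real a + real b))
       = log 2 (real ((a + b) ^ (a + b))) - log 2 (real (a ^ a * b ^ b))"
proof -
  define n where "n = real a + real b"
  have n: "n > 0"
    using assms by (simp add: n_def)
  have "1 - real a / n = real b / n"
    using n by (simp add: n_def field_simps)
  then have "n * binary_entropy (real a / n)
      = n * (real a / n) * - log 2 (real a / n) - n * (real b / n) * log 2 (real b / n)"
    by (simp add: binary_entropy_def right_diff_distrib)
  also have "\<dots> = - real a * log 2 (real a / n) - real b * log 2 (real b / n)"
    using n by simp
  also have "\<dots> = log 2 (real ((a + b) ^ (a + b))) - log 2 (real (a ^ a * b ^ b))"
    using assms n by (simp add: n_def log_divide log_mult log_nat_power algebra_simps)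
  finally show ?thesis
    unfolding n_def .
qed

lemma binary_entropy_nat_le_iff:
  assumes "a > 0" "b > 0"
  shows "(real a + real b) * binary_entropy (real a / (real a + real b)) \<le> real k
           \<longleftrightarrow> (a + b) ^ (a + b) \<le> 2 ^ k * (a ^ a * b ^ b)"
    and "real k \<le> (real a + real b) * binary_entropy (real a / (real a + real b))
           \<longleftrightarrow> 2 ^ k * (a ^ a * b ^ b) \<le> (a + b) ^ (a + b)"
proof -
  define X Y where "X = (a + b) ^ (a + b)" and "Y = a ^ a * b ^ b"
  have XY: "X > 0" "Y > 0"
    using assms by (auto simp: X_def Y_def)
  then have k: "real k + log 2 (real Y) = log 2 (real (2 ^ k * Y))"
    by (simp add: log_mult log_nat_power)
  note eq = binary_entropy_nat[OF assms, folded X_def Y_def]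
  have "log 2 (real X) \<le> log 2 (real (2 ^ k * Y)) \<longleftrightarrow> X \<le> 2 ^ k * Y"
       "log 2 (real (2 ^ k * Y)) \<le> log 2 (real X) \<longleftrightarrow> 2 ^ k * Y \<le> X"
    using XY by (subst log_le_cancel_iff; simp only: of_nat_le_iff of_nat_0_less_iff; simp)+
  then show "(real a + real b) * binary_entropy (real a / (real a + real b)) \<le> real k \<longleftrightarrow> X \<le> 2 ^ k * Y"
       "real k \<le> (real a + real b) * binary_entropy (real a / (real a + real b)) \<longleftrightarrow> 2 ^ k * Y \<le> X"
    unfolding eq k[symmetric] by linarith+
qed

lemma binary_entropy_11_100: "binary_entropy (11 / 100) \<le> 1 / 2"
proof -
  \<comment> \<open>The exponent \<open>50\<close> is \<open>100 * (1 / 2)\<close>; doubling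
    \<open>11 / 100\<close> gives the bound \<open>0.220\<close>.\<close>
  have "(11 + 89 :: nat) ^ (11 + 89) \<le> 2 ^ 50 * (11 ^ 11 * 89 ^ 89)"
    by (simp only: power_numeral pow.simps sqr.simps numeral_times_numeral numeral_plus_numeral
        numeral_le_iff mult_num_simps add_num_simps le_num_simps less_num_simps)
  then have "(real 11 + real 89) * binary_entropy (real 11 / (real 11 + real 89)) \<le> real 50"
    by (rule iffD2[OF binary_entropy_nat_le_iff(1), rotated 2]) simp_all
  then show ?thesis
    by simp
qed

text \<open>Doubling \<open>13 / 118\<close> gives about \<open>0.2203\<close>, which is below
  \<open>0.221\<close>.\<close>

lemma binary_entropy_13_118: "1 / 2 \<le> binary_entropy (13 / 118)"
proof -
  have "2 ^ 59 * (13 ^ 13 * 105 ^ 105) \<le> (13 + 105 :: nat) ^ (13 + 105)"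
    by (simp only: power_numeral pow.simps sqr.simps numeral_times_numeral numeral_plus_numeral
        numeral_le_iff mult_num_simps add_num_simps le_num_simps less_num_simps)
  then have "real 59 \<le> (real 13 + real 105) * binary_entropy (real 13 / (real 13 + real 105))"
    by (rule iffD2[OF binary_entropy_nat_le_iff(2), rotated 2]) simp_all
  then show ?thesis
    by simp
qed

text \<open>The intermediate value theorem yields a preimage of \<open>1 / 2\<close> between the two
  rational bounds, and strict monotonicity identifies it with the value of
  \<open>the_inv_into\<close>.\<close>

lemma inv_binary_entropy_half:
  defines "h \<equiv> inv_binary_entropy (1 / 2)"
  shows "binary_entropy h = 1 / 2" "11 / 100 \<le> h" "h \<le> 13 / 118"
proof -
  have "continuous_on {11 / 100..13 / 118} binary_entropy"
    unfolding binary_entropy_def by (intro continuous_intros) auto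
  then obtain z where z: "11 / 100 \<le> z" "z \<le> 13 / 118" "binary_entropy z = 1 / 2"
    using IVT'[of binary_entropy "11 / 100" "1 / 2" "13 / 118"] binary_entropy_11_100 binary_entropy_13_118
    by auto
  moreover have "h = z"
    unfolding h_def inv_binary_entropy_def
    using z by (intro the_inv_into_f_eq strict_mono_on_imp_inj_on binary_entropy_strict_mono) auto
  ultimately show "binary_entropy h = 1 / 2" "11 / 100 \<le> h" "h \<le> 13 / 118"
    by auto
qed

subsection \<open>The limit\<close>

lemma prob_random_necklace:
  "measure_pmf.prob (random_necklace 2 t 1) {xs. P (min_cuts 2 t 1 xs)}
     = real (card {xs \<in> double_words {..<t}. P (min_changes xs)}) / real (card (double_words {..<t}))"
proof -
  have "measure_pmf.prob (random_necklace 2 t 1) {xs. P (min_cuts 2 t 1 xs)}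
      = real (card (double_words {..<t} \<inter> {xs. P (min_cuts 2 t 1 xs)})) / real (card (double_words {..<t}))"
    using measure_pmf_of_set[OF necklaces_nonempty finite_necklaces, of 2 t 1]
    by (simp only: random_necklace_def necklaces_eq_double_words)
  also have "double_words {..<t} \<inter> {xs. P (min_cuts 2 t 1 xs)} = {xs \<in> double_words {..<t}. P (min_changes xs)}"
    using min_cuts_eq_min_changes[of _ t] by (auto simp del: One_nat_def)
  finally show ?thesis .
qed

lemma card_double_words_pos: "0 < card (double_words S)"
  by (simp add: card_gt_0_iff double_words_def)

lemma prob_min_cuts_gt:
  assumes "\<epsilon> > 0"
  shows "(\<lambda>t. measure_pmf.prob (random_necklace 2 t 1)
           {xs. real (min_cuts 2 t 1 xs) > (2 / 5 + \<epsilon>) * real t}) \<longlonglongrightarrow> 0"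
proof (rule tendsto_sandwich[OF _ _ tendsto_const])
  show "\<forall>\<^sub>F t in sequentially. measure_pmf.prob (random_necklace 2 t 1)
          {xs. real (min_cuts 2 t 1 xs) > (2 / 5 + \<epsilon>) * real t} \<le> 1 / (\<epsilon>\<^sup>2 * real t)"
    using eventually_gt_at_top[of 0]
  proof eventually_elim
    case (elim t)
    have "real (card {xs \<in> double_words {..<t}. real (min_changes xs) > (2 / 5 + \<epsilon>) * real t})
        \<le> real (card (double_words {..<t})) / (\<epsilon>\<^sup>2 * real t)"
      using card_min_changes_gt[of "{..<t}" \<epsilon>] elim assms by auto
    then show ?case
      unfolding prob_random_necklace[of t "\<lambda>m. real m > (2 / 5 + \<epsilon>) * real t"]
      using card_double_words_pos[of "{..<t}"] by (subst pos_divide_le_eq) simp_all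
  qed
  have "(\<lambda>t. 1 / \<epsilon>\<^sup>2 * (1 / real t)) \<longlonglongrightarrow> 1 / \<epsilon>\<^sup>2 * 0"
    by (intro tendsto_mult tendsto_const lim_1_over_n)
  then show "(\<lambda>t. 1 / (\<epsilon>\<^sup>2 * real t)) \<longlonglongrightarrow> 0"
    by simp
qed auto

lemma prob_min_cuts_le:
  assumes "0 < q" "q \<le> 1 / 2" "binary_entropy q < 1 / 2"
  shows "(\<lambda>t. measure_pmf.prob (random_necklace 2 t 1)
           {xs. real (min_cuts 2 t 1 xs) \<le> 2 * q * real t}) \<longlonglongrightarrow> 0"
proof (rule tendsto_sandwich[OF _ _ tendsto_const])
  define \<rho> where "\<rho> = 2 powr (2 * binary_entropy q - 1)"
  show "\<forall>\<^sub>F t in sequentially. measure_pmf.prob (random_necklace 2 t 1)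
          {xs. real (min_cuts 2 t 1 xs) \<le> 2 * q * real t} \<le> 4 * (real t * \<rho> ^ t)"
    using eventually_gt_at_top[of 0]
  proof eventually_elim
    case (elim t)
    have "real (card {xs \<in> double_words {..<t}. real (min_changes xs) \<le> 2 * q * real t})
        \<le> real (card (double_words {..<t})) * (4 * (real t * \<rho> ^ t))"
      using card_min_changes_le_entropy[of "{..<t}" q] elim assms by (auto simp: \<rho>_def mult_ac)
    then show ?case
      unfolding prob_random_necklace[of t "\<lambda>m. real m \<le> 2 * q * real t"]
      using card_double_words_pos[of "{..<t}"] by (subst pos_divide_le_eq) (simp_all add: mult_ac)
  qed
  \<comment> \<open>The entropy below \<open>1 / 2\<close> gives geometric decay, which beats the
    factor \<open>t\<close>.\<close>
  have "0 \<le> \<rho>" "\<rho> < 1"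
    using assms(3) by (auto simp: \<rho>_def intro: powr_less_one)
  then have "(\<lambda>t. real t * \<rho> ^ t) \<longlonglongrightarrow> 0"
    by (intro powser_times_n_limit_0) simp
  then have "(\<lambda>t. 4 * (real t * \<rho> ^ t)) \<longlonglongrightarrow> 4 * 0"
    by (intro tendsto_mult tendsto_const)
  then show "(\<lambda>t. 4 * (real t * \<rho> ^ t)) \<longlonglongrightarrow> 0"
    by simp
qed auto

lemma prob_min_cuts_less:
  assumes "\<epsilon> > 0"
  shows "(\<lambda>t. measure_pmf.prob (random_necklace 2 t 1)
           {xs. real (min_cuts 2 t 1 xs) < (2 * inv_binary_entropy (1 / 2) - \<epsilon>) * real t}) \<longlonglongrightarrow> 0"
proof -
  define h where "h = inv_binary_entropy (1 / 2)"
  note h = inv_binary_entropy_half[folded h_def]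
  \<comment> \<open>The first argument ensures \<open>2 * q \<ge> 2 * h - \<epsilon>\<close>; the
    second keeps \<open>q\<close> positive when \<epsilon> is large. Both are less than
    \<open>h\<close>.\<close>
  define q where "q = max (h - \<epsilon> / 2) (h / 2)"
  have q: "0 < q" "q \<le> 1 / 2" "q < h"
    using h assms by (auto simp: q_def max_def)
  have "binary_entropy q < 1 / 2"
    unfolding h(1)[symmetric] using q h by (intro strict_mono_onD[OF binary_entropy_strict_mono]) auto
  from prob_min_cuts_le[OF q(1,2) this] show ?thesis
  proof (rule tendsto_sandwich[OF _ _ tendsto_const, rotated 2])
    have "(2 * h - \<epsilon>) * real t \<le> 2 * q * real t" for t
      by (intro mult_right_mono) (auto simp: q_def max_def)
    then have "{xs. real (min_cuts 2 t 1 xs) < (2 * h - \<epsilon>) * real t}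
        \<subseteq> {xs. real (min_cuts 2 t 1 xs) \<le> 2 * q * real t}" for t
      using order.trans less_imp_le by blast
    then show "\<forall>\<^sub>F t in sequentially. measure_pmf.prob (random_necklace 2 t 1)
            {xs. real (min_cuts 2 t 1 xs) < (2 * inv_binary_entropy (1 / 2) - \<epsilon>) * real t}
          \<le> measure_pmf.prob (random_necklace 2 t 1) {xs. real (min_cuts 2 t 1 xs) \<le> 2 * q * real t}"
      unfolding h_def by (intro always_eventually allI measure_pmf.finite_measure_mono) auto
  qed auto
qed

theorem theorem1p4:
  "(\<forall>\<epsilon>::real. \<epsilon> > 0 \<longrightarrow>
      (\<lambda>t::nat. measure_pmf.prob (random_necklace 2 t 1)
         {xs. (2 * inv_binary_entropy (1/2) - \<epsilon>) * real t \<le> real (min_cuts 2 t 1 xs) \<and>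
              real (min_cuts 2 t 1 xs) \<le> (0.4 + \<epsilon>) * real t}) \<longlonglongrightarrow> 1) \<and>
   0.220 \<le> 2 * inv_binary_entropy (1/2) \<and> 2 * inv_binary_entropy (1/2) < 0.221"
proof (intro conjI allI impI)
  fix \<epsilon> :: real
  assume \<epsilon>: "\<epsilon> > 0"
  let ?P = "\<lambda>t. measure_pmf.prob (random_necklace 2 t 1)"
  let ?A = "\<lambda>t. {xs. real (min_cuts 2 t 1 xs) < (2 * inv_binary_entropy (1 / 2) - \<epsilon>) * real t}"
  let ?B = "\<lambda>t. {xs. real (min_cuts 2 t 1 xs) > (2 / 5 + \<epsilon>) * real t}"
  let ?G = "\<lambda>t. {xs. (2 * inv_binary_entropy (1/2) - \<epsilon>) * real t \<le> real (min_cuts 2 t 1 xs) \<and>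
              real (min_cuts 2 t 1 xs) \<le> (0.4 + \<epsilon>) * real t}"
  have G: "?G t = - (?A t \<union> ?B t)" for t
    by auto
  \<comment> \<open>A union bound over the two bad events, whose probabilities both tend to
    \<open>0\<close>.\<close>
  have "1 - (?P t (?A t) + ?P t (?B t)) \<le> ?P t (?G t)" for t
    unfolding G Compl_eq_Diff_UNIV
    using measure_pmf.prob_compl[of "?A t \<union> ?B t" "random_necklace 2 t 1"]
      measure_Un_le[of "?A t" "random_necklace 2 t 1" "?B t"] by simp
  moreover have "(\<lambda>t. 1 - (?P t (?A t) + ?P t (?B t))) \<longlonglongrightarrow> 1 - (0 + 0)"
    by (intro tendsto_intros prob_min_cuts_less prob_min_cuts_gt \<epsilon>)
  ultimately show "(\<lambda>t. ?P t (?G t)) \<longlonglongrightarrow> 1"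
    by (intro tendsto_sandwich[of _ "\<lambda>t. ?P t (?G t)" _ "\<lambda>_. 1"])
       (auto intro!: always_eventually)
qed (use inv_binary_entropy_half in auto)

end
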